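(* Let $\mathcal A$ be a well-founded $\Sigma$-algebra, $\succsim$ a quasi-precedence and $\sigma$ a status. If $\mathcal A$ is strictly simple, then $\succ_{\mathrm{GKBO}}=\succ_{\mathrm{WPO}}$, where both orders are induced by $\mathcal A$, $\succsim$ and $\sigma$.
   Context: Terms over a finite signature $\Sigma$ and variables $\mathcal V$. A well-founded $\Sigma$-algebra $\mathcal{A}=(A,\geq,>,(f_{\mathcal A}))$: carrier $A$, quasi-order $\geq$, well-founded strict order $>$ with ${\geq}\circ{>}\circ{\geq}\subseteq{>}$, and $f_{\mathcal A}:A^n\to A$ for $f\in\Sigma_n$. On terms, $s\geq_{\mathcal A}t$ (resp. $>_{\mathcal A}$) iff $\hat\alpha(s)\geq\hat\alpha(t)$ (resp. $>$) for all assignments $\alpha:\mathcal V\to A$. $\mathcal A$ is strictly simple iff $f_{\mathcal A}(\dots,a,\dots)>a$ for every $f$ and argument position. A quasi-precedence $\succsim$ is a quasi-order on $\Sigma$ with well-founded strict part $\succ$ and equivalence part $\sim$. A status $\sigma$ maps $f\in\Sigma_n$ to a permutation $[i_1,\dots,i_n]$ of $\{1,\dots,n\}$, and $\sigma(f)(s_1,\dots,s_n)=[s_{i_1},\dots,s_{i_n}]$. For a strict order $\succ$ with reflexive closure $\succeq$: $[s_1,\dots,s_n]\succ^{\mathrm{lex}}[t_1,\dots,t_m]$ iff there is $k<n$ with $s_i\succeq t_i$ for $i\le k$ and either $k=m$, or $k<m$ and $s_{k+1}\succ t_{k+1}$. GKBO: no variable is greater than any term; $s=f(s_1,\dots,s_n)\succ_{\mathrm{GKBO}}t$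 iff (1) $s>_{\mathcal A}t$, or (2) $s\geq_{\mathcal A}t=g(t_1,\dots,t_m)$ and either $f\succ g$, or $f\sim g$ and $\sigma(f)(s_1,\dots,s_n)\succ_{\mathrm{GKBO}}^{\mathrm{lex}}\sigma(g)(t_1,\dots,t_m)$. WPO: no variable is greater than any term; $s=f(s_1,\dots,s_n)\succ_{\mathrm{WPO}}t$ iff (1) $s>_{\mathcal A}t$, or (2) $s\geq_{\mathcal A}t$ and either (a) $s_i\succeq_{\mathrm{WPO}}t$ for some $i\in\{1,\dots,n\}$, or (b) $t=g(t_1,\dots,t_m)$, $s\succ_{\mathrm{WPO}}t_j$ for all $j$, and either $f\succ g$, or $f\sim g$ and $\sigma(f)(s_1,\dots,s_n)\succ_{\mathrm{WPO}}^{\mathrm{lex}}\sigma(g)(t_1,\dots,t_m)$. *)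

theory Defs
  imports Main
begin

datatype ('f, 'v) trm = Var 'v | Fun 'f "('f, 'v) trm list"

text \<open>A signature is a set \<open>F\<close> of symbols together with an arity function \<open>ar\<close>;
  \<open>terms F ar\<close> is the set of terms over it, the variables being the elements of the type \<open>'v\<close>.\<close>

inductive_set terms :: "'f set \<Rightarrow> ('f \<Rightarrow> nat) \<Rightarrow> ('f, 'v) trm set"
  for F :: "'f set" and ar :: "'f \<Rightarrow> nat" where
  Var: "Var x \<in> terms F ar"
| Fun: "f \<in> F \<Longrightarrow> length ts = ar f \<Longrightarrow> (\<And>t. t \<in> set ts \<Longrightarrow> t \<in> terms F ar) \<Longrightarrow>
    Fun f ts \<in> terms F ar"

text \<open>The relations and interpretation functions matter only on the carrier (and, for the
  interpretation of \<open>f\<close>, on argument lists of length \<open>ar f\<close>).\<close>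

record ('f, 'a) ord_algebra =
  carrier :: "'a set"
  geq :: "'a \<Rightarrow> 'a \<Rightarrow> bool"
  gt :: "'a \<Rightarrow> 'a \<Rightarrow> bool"
  interp :: "'f \<Rightarrow> 'a list \<Rightarrow> 'a"

definition well_founded_algebra ::
  "'f set \<Rightarrow> ('f \<Rightarrow> nat) \<Rightarrow> ('f, 'a) ord_algebra \<Rightarrow> bool" where
  "well_founded_algebra F ar \<A> \<longleftrightarrow>
    (\<forall>f \<in> F. \<forall>as. length as = ar f \<longrightarrow> set as \<subseteq> carrier \<A> \<longrightarrow> interp \<A> f as \<in> carrier \<A>) \<and>
    reflp_on (carrier \<A>) (geq \<A>) \<and> transp_on (carrier \<A>) (geq \<A>) \<and>
    irreflp_on (carrier \<A>) (gt \<A>) \<and> transp_on (carrier \<A>) (gt \<A>) \<and>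
    wfp_on (carrier \<A>) (gt \<A>)\<inverse>\<inverse> \<and>
    (\<forall>a \<in> carrier \<A>. \<forall>b \<in> carrier \<A>. \<forall>c \<in> carrier \<A>. \<forall>d \<in> carrier \<A>.
      geq \<A> a b \<longrightarrow> gt \<A> b c \<longrightarrow> geq \<A> c d \<longrightarrow> gt \<A> a d)"

definition strictly_simple ::
  "'f set \<Rightarrow> ('f \<Rightarrow> nat) \<Rightarrow> ('f, 'a) ord_algebra \<Rightarrow> bool" where
  "strictly_simple F ar \<A> \<longleftrightarrow>
    (\<forall>f \<in> F. \<forall>as. length as = ar f \<longrightarrow> set as \<subseteq> carrier \<A> \<longrightarrow>
      (\<forall>i < ar f. gt \<A> (interp \<A> f as) (as ! i)))"

primrec eval :: "('f, 'a) ord_algebra \<Rightarrow> ('v \<Rightarrow> 'a) \<Rightarrow> ('f, 'v) trm \<Rightarrow> 'a" where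
  "eval \<A> \<alpha> (Var x) = \<alpha> x"
| "eval \<A> \<alpha> (Fun f ts) = interp \<A> f (map (eval \<A> \<alpha>) ts)"

definition trm_geq :: "('f, 'a) ord_algebra \<Rightarrow> ('f, 'v) trm \<Rightarrow> ('f, 'v) trm \<Rightarrow> bool" where
  "trm_geq \<A> s t \<longleftrightarrow>
    (\<forall>\<alpha>. (\<forall>x. \<alpha> x \<in> carrier \<A>) \<longrightarrow> geq \<A> (eval \<A> \<alpha> s) (eval \<A> \<alpha> t))"

definition trm_gt :: "('f, 'a) ord_algebra \<Rightarrow> ('f, 'v) trm \<Rightarrow> ('f, 'v) trm \<Rightarrow> bool" where
  "trm_gt \<A> s t \<longleftrightarrow>
    (\<forall>\<alpha>. (\<forall>x. \<alpha> x \<in> carrier \<A>) \<longrightarrow> gt \<A> (eval \<A> \<alpha> s) (eval \<A> \<alpha> t))"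

definition strict_part :: "('f \<Rightarrow> 'f \<Rightarrow> bool) \<Rightarrow> 'f \<Rightarrow> 'f \<Rightarrow> bool" where
  "strict_part pr f g \<longleftrightarrow> pr f g \<and> \<not> pr g f"

definition equiv_part :: "('f \<Rightarrow> 'f \<Rightarrow> bool) \<Rightarrow> 'f \<Rightarrow> 'f \<Rightarrow> bool" where
  "equiv_part pr f g \<longleftrightarrow> pr f g \<and> pr g f"

definition quasi_precedence :: "'f set \<Rightarrow> ('f \<Rightarrow> 'f \<Rightarrow> bool) \<Rightarrow> bool" where
  "quasi_precedence F pr \<longleftrightarrow>
    reflp_on F pr \<and> transp_on F pr \<and> wfp_on F (strict_part pr)\<inverse>\<inverse>"

text \<open>Argument positions are counted from 0, so \<open>\<sigma> f\<close> is a permutation of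
  \<open>0, \<dots>, ar f - 1\<close> written as a list.\<close>

definition status :: "'f set \<Rightarrow> ('f \<Rightarrow> nat) \<Rightarrow> ('f \<Rightarrow> nat list) \<Rightarrow> bool" where
  "status F ar \<sigma> \<longleftrightarrow> (\<forall>f \<in> F. distinct (\<sigma> f) \<and> set (\<sigma> f) = {..<ar f})"

definition permute_args :: "nat list \<Rightarrow> 'b list \<Rightarrow> 'b list" where
  "permute_args p ss = map (\<lambda>i. ss ! i) p"

definition lex_ext :: "('b \<Rightarrow> 'b \<Rightarrow> bool) \<Rightarrow> 'b list \<Rightarrow> 'b list \<Rightarrow> bool" where
  "lex_ext R ss ts \<longleftrightarrow>
    (\<exists>k < length ss.
      (k = length ts \<or> k < length ts \<and> R (ss ! k) (ts ! k)) \<and>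
      (\<forall>i < k. R\<^sup>=\<^sup>= (ss ! i) (ts ! i)))"

lemma lex_ext_mono [mono]:
  assumes "\<And>x y. R x y \<longrightarrow> S x y"
  shows "lex_ext R ss ts \<longrightarrow> lex_ext S ss ts"
  using assms unfolding lex_ext_def by (simp; blast)

text \<open>Both orders are recursive in strictly smaller pairs of terms, so the least relations closed
  under the following rules are the only ones satisfying the recursive equivalences
  \<open>gkbo_Fun_iff\<close> and \<open>wpo_Fun_iff\<close> below.\<close>

inductive gkbo ::
  "'f set \<Rightarrow> ('f \<Rightarrow> nat) \<Rightarrow> ('f, 'a) ord_algebra \<Rightarrow> ('f \<Rightarrow> 'f \<Rightarrow> bool) \<Rightarrow> ('f \<Rightarrow> nat list) \<Rightarrow>
    ('f, 'v) trm \<Rightarrow> ('f, 'v) trm \<Rightarrow> bool"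
  for F ar \<A> pr \<sigma> where
  gkbo_alg: "Fun f ss \<in> terms F ar \<Longrightarrow> t \<in> terms F ar \<Longrightarrow> trm_gt \<A> (Fun f ss) t \<Longrightarrow>
    gkbo F ar \<A> pr \<sigma> (Fun f ss) t"
| gkbo_sym: "Fun f ss \<in> terms F ar \<Longrightarrow> Fun g ts \<in> terms F ar \<Longrightarrow>
    trm_geq \<A> (Fun f ss) (Fun g ts) \<Longrightarrow>
    strict_part pr f g \<or>
    equiv_part pr f g \<and>
      lex_ext (gkbo F ar \<A> pr \<sigma>) (permute_args (\<sigma> f) ss) (permute_args (\<sigma> g) ts) \<Longrightarrow>
    gkbo F ar \<A> pr \<sigma> (Fun f ss) (Fun g ts)"

inductive wpo ::
  "'f set \<Rightarrow> ('f \<Rightarrow> nat) \<Rightarrow> ('f, 'a) ord_algebra \<Rightarrow> ('f \<Rightarrow> 'f \<Rightarrow> bool) \<Rightarrow> ('f \<Rightarrow> nat list) \<Rightarrow>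
    ('f, 'v) trm \<Rightarrow> ('f, 'v) trm \<Rightarrow> bool"
  for F ar \<A> pr \<sigma> where
  wpo_alg: "Fun f ss \<in> terms F ar \<Longrightarrow> t \<in> terms F ar \<Longrightarrow> trm_gt \<A> (Fun f ss) t \<Longrightarrow>
    wpo F ar \<A> pr \<sigma> (Fun f ss) t"
| wpo_arg: "Fun f ss \<in> terms F ar \<Longrightarrow> t \<in> terms F ar \<Longrightarrow> trm_geq \<A> (Fun f ss) t \<Longrightarrow>
    \<exists>i < length ss. ss ! i = t \<or> wpo F ar \<A> pr \<sigma> (ss ! i) t \<Longrightarrow>
    wpo F ar \<A> pr \<sigma> (Fun f ss) t"
| wpo_sym: "Fun f ss \<in> terms F ar \<Longrightarrow> Fun g ts \<in> terms F ar \<Longrightarrow>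
    trm_geq \<A> (Fun f ss) (Fun g ts) \<Longrightarrow>
    \<forall>j < length ts. wpo F ar \<A> pr \<sigma> (Fun f ss) (ts ! j) \<Longrightarrow>
    strict_part pr f g \<or>
    equiv_part pr f g \<and>
      lex_ext (wpo F ar \<A> pr \<sigma>) (permute_args (\<sigma> f) ss) (permute_args (\<sigma> g) ts) \<Longrightarrow>
    wpo F ar \<A> pr \<sigma> (Fun f ss) (Fun g ts)"

lemma gkbo_Var: "\<not> gkbo F ar \<A> pr \<sigma> (Var x) t"
  by (auto elim: gkbo.cases)

lemma gkbo_Fun_iff:
  assumes "Fun f ss \<in> terms F ar" and "t \<in> terms F ar"
  shows "gkbo F ar \<A> pr \<sigma> (Fun f ss) t \<longleftrightarrow>
    trm_gt \<A> (Fun f ss) t \<or>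
    trm_geq \<A> (Fun f ss) t \<and>
      (\<exists>g ts. t = Fun g ts \<and>
        (strict_part pr f g \<or>
         equiv_part pr f g \<and>
           lex_ext (gkbo F ar \<A> pr \<sigma>) (permute_args (\<sigma> f) ss) (permute_args (\<sigma> g) ts)))"
  using assms by (subst gkbo.simps) auto

lemma wpo_Var: "\<not> wpo F ar \<A> pr \<sigma> (Var x) t"
  by (auto elim: wpo.cases)

lemma wpo_Fun_iff:
  assumes "Fun f ss \<in> terms F ar" and "t \<in> terms F ar"
  shows "wpo F ar \<A> pr \<sigma> (Fun f ss) t \<longleftrightarrow>
    trm_gt \<A> (Fun f ss) t \<or>
    trm_geq \<A> (Fun f ss) t \<and>
      ((\<exists>i < length ss. (wpo F ar \<A> pr \<sigma>)\<^sup>=\<^sup>= (ss ! i) t) \<or>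
       (\<exists>g ts. t = Fun g ts \<and>
         (\<forall>j < length ts. wpo F ar \<A> pr \<sigma> (Fun f ss) (ts ! j)) \<and>
         (strict_part pr f g \<or>
          equiv_part pr f g \<and>
            lex_ext (wpo F ar \<A> pr \<sigma>) (permute_args (\<sigma> f) ss) (permute_args (\<sigma> g) ts))))"
  using assms by (subst wpo.simps) auto

end

theory Submission
  imports Defs
begin

text \<open>Strict simplicity makes every term \<open>>\<^sub>\<A>\<close>-greater than its arguments. Hence the argument
  case (2a) of WPO is subsumed by the algebra case (1), and the requirement
  \<open>s \<succ> t\<^sub>j\<close> of case (2b) holds by case (1), since \<open>s \<ge>\<^sub>\<A> t >\<^sub>\<A> t\<^sub>j\<close>. What remains of WPO
  is exactly GKBO.\<close>

text \<open>The order laws and strict simplicity are assumed only on the carrier, so each use of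
  them at values of terms rests on this membership.\<close>

lemma eval_in_carrier:
  assumes "well_founded_algebra F ar \<A>" and "\<forall>x. \<alpha> x \<in> carrier \<A>" and "t \<in> terms F ar"
  shows "eval \<A> \<alpha> t \<in> carrier \<A>"
  using assms(3)
proof induction
  case (Var x)
  then show ?case using assms(2) by simp
next
  case (Fun f ts)
  then have "length (map (eval \<A> \<alpha>) ts) = ar f" "set (map (eval \<A> \<alpha>) ts) \<subseteq> carrier \<A>"
    by auto
  then show ?case
    using assms(1) Fun.hyps(1) unfolding well_founded_algebra_def by (simp del: set_map)
qed

lemma terms_arg:
  assumes "Fun f ts \<in> terms F ar" and "i < length ts"
  shows "ts ! i \<in> terms F ar"
  using assms by (auto elim: terms.cases)

lemma trm_gt_arg:
  assumes "well_founded_algebra F ar \<A>" and "strictly_simple F ar \<A>"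
    and "Fun f ts \<in> terms F ar" and "i < length ts"
  shows "trm_gt \<A> (Fun f ts) (ts ! i)"
  unfolding trm_gt_def
proof (intro allI impI)
  fix \<alpha> :: "'c \<Rightarrow> 'b"
  assume \<alpha>: "\<forall>x. \<alpha> x \<in> carrier \<A>"
  have f: "f \<in> F" "length ts = ar f" and ts: "\<And>t. t \<in> set ts \<Longrightarrow> t \<in> terms F ar"
    using assms(3) by (auto elim: terms.cases)
  have "set (map (eval \<A> \<alpha>) ts) \<subseteq> carrier \<A>"
    using eval_in_carrier[OF assms(1) \<alpha>] ts by auto
  then have "gt \<A> (interp \<A> f (map (eval \<A> \<alpha>) ts)) (map (eval \<A> \<alpha>) ts ! i)"
    using assms(2,4) f unfolding strictly_simple_def by (metis length_map)
  then show "gt \<A> (eval \<A> \<alpha> (Fun f ts)) (eval \<A> \<alpha> (ts ! i))"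
    using assms(4) by simp
qed

lemma
  assumes "well_founded_algebra F ar \<A>"
    and "s \<in> terms F ar" and "t \<in> terms F ar" and "u \<in> terms F ar"
  shows trm_gt_trans: "trm_gt \<A> s t \<Longrightarrow> trm_gt \<A> t u \<Longrightarrow> trm_gt \<A> s u"
    and trm_gt_geq_trans: "trm_gt \<A> s t \<Longrightarrow> trm_geq \<A> t u \<Longrightarrow> trm_gt \<A> s u"
    and trm_geq_gt_trans: "trm_geq \<A> s t \<Longrightarrow> trm_gt \<A> t u \<Longrightarrow> trm_gt \<A> s u"
proof -
  have refl: "geq \<A> a a" if "a \<in> carrier \<A>" for a
    using assms(1) that by (simp add: well_founded_algebra_def reflp_on_def)
  have trans: "gt \<A> a c"
    if "a \<in> carrier \<A>" "b \<in> carrier \<A>" "c \<in> carrier \<A>" "gt \<A> a b" "gt \<A> b c" for a b c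
  proof -
    have "transp_on (carrier \<A>) (gt \<A>)"
      using assms(1) by (simp add: well_founded_algebra_def)
    then show ?thesis using that by (rule transp_onD)
  qed
  have compat: "gt \<A> a d"
    if "a \<in> carrier \<A>" "b \<in> carrier \<A>" "c \<in> carrier \<A>" "d \<in> carrier \<A>"
      "geq \<A> a b" "gt \<A> b c" "geq \<A> c d" for a b c d
    using assms(1) that unfolding well_founded_algebra_def by metis
  note eval_s = eval_in_carrier[OF assms(1) _ assms(2)]
    and eval_t = eval_in_carrier[OF assms(1) _ assms(3)]
    and eval_u = eval_in_carrier[OF assms(1) _ assms(4)]
  show "trm_gt \<A> s u" if "trm_gt \<A> s t" "trm_gt \<A> t u"
    using that trans[OF eval_s eval_t eval_u] unfolding trm_gt_def by simp
  \<comment> \<open>\<open>compat\<close> has a weak step on both sides of the strict one.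
    Reflexivity at the value of \<open>s\<close> fills the left one here; for the last claim,
    reflexivity at the value of \<open>u\<close> fills the right one.\<close>
  show "trm_gt \<A> s u" if "trm_gt \<A> s t" "trm_geq \<A> t u"
    using that compat[OF eval_s eval_s eval_t eval_u] refl[OF eval_s]
    unfolding trm_gt_def trm_geq_def by simp
  show "trm_gt \<A> s u" if "trm_geq \<A> s t" "trm_gt \<A> t u"
    using that compat[OF eval_s eval_t eval_u eval_u] refl[OF eval_u]
    unfolding trm_gt_def trm_geq_def by simp
qed

text \<open>Each rule of \<open>wpo\<close> has one of the two comparisons as a premise. The
  disjunction stays because \<open>gt\<close> is not assumed to be contained in
  \<open>geq\<close>.\<close>

lemma wpo_imp_trm_gt_or_geq:
  assumes "wpo F ar \<A> pr \<sigma> s t"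
  shows "trm_gt \<A> s t \<or> trm_geq \<A> s t"
  using assms by cases auto

text \<open>Rule induction replaces a recursion on pairs of terms: the comparisons made inside
  \<open>lex_ext\<close> carry their own induction hypotheses. Only the condition on the arguments
  of the right-hand side has to be added.\<close>

lemma gkbo_imp_wpo:
  assumes "well_founded_algebra F ar \<A>" and "strictly_simple F ar \<A>"
    and "gkbo F ar \<A> pr \<sigma> s t"
  shows "wpo F ar \<A> pr \<sigma> s t"
  using assms(3)
proof induction
  case (gkbo_alg f ss t)
  then show ?case by (rule wpo_alg)
next
  case (gkbo_sym f ss g ts)
  have "wpo F ar \<A> pr \<sigma> (Fun f ss) (ts ! j)" if "j < length ts" for j
  proof -
    note tj = terms_arg[OF gkbo_sym.hyps(2) that]
    have "trm_gt \<A> (Fun f ss) (ts ! j)"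
      using trm_geq_gt_trans[OF assms(1) gkbo_sym.hyps(1,2) tj gkbo_sym.hyps(3)]
        trm_gt_arg[OF assms(1,2) gkbo_sym.hyps(2) that] .
    with gkbo_sym.hyps(1) tj show ?thesis by (rule wpo_alg)
  qed
  \<comment> \<open>The induction hypothesis is a lexicographic comparison by the conjunction of
    both orders; monotonicity projects it to \<open>wpo\<close>.\<close>
  moreover have "lex_ext (wpo F ar \<A> pr \<sigma>) us vs"
    if "lex_ext (\<lambda>x y. gkbo F ar \<A> pr \<sigma> x y \<and> wpo F ar \<A> pr \<sigma> x y) us vs" for us vs
    using that by (rule lex_ext_mono[rule_format, rotated]) simp
  ultimately show ?case
    using gkbo_sym by (intro wpo_sym) blast+
qed

lemma wpo_imp_gkbo:
  assumes "well_founded_algebra F ar \<A>" and "strictly_simple F ar \<A>"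
    and "wpo F ar \<A> pr \<sigma> s t"
  shows "gkbo F ar \<A> pr \<sigma> s t"
  using assms(3)
proof induction
  case (wpo_alg f ss t)
  then show ?case by (rule gkbo_alg)
next
  case (wpo_arg f ss t)
  then obtain i where i: "i < length ss" "ss ! i = t \<or> wpo F ar \<A> pr \<sigma> (ss ! i) t"
    by blast
  have gt: "trm_gt \<A> (Fun f ss) (ss ! i)"
    using trm_gt_arg[OF assms(1,2)] wpo_arg.hyps(1) i(1) .
  \<comment> \<open>Either \<open>ss ! i\<close> is \<open>t\<close> itself, or it is related to
    \<open>t\<close> by \<open>trm_gt\<close> or \<open>trm_geq\<close>; composing with
    \<open>gt\<close> gives a strict comparison in all three cases.\<close>
  have "trm_gt \<A> (Fun f ss) t"
    using i(2) gt wpo_imp_trm_gt_or_geq terms_arg[OF wpo_arg.hyps(1) i(1)] wpo_arg.hyps(1,2)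
      trm_gt_trans[OF assms(1)] trm_gt_geq_trans[OF assms(1)]
    by metis
  with wpo_arg.hyps(1,2) show ?case by (rule gkbo_alg)
next
  case (wpo_sym f ss g ts)
  \<comment> \<open>The same projection, now to \<open>gkbo\<close>; the comparisons with the
    arguments \<open>ts ! j\<close> are simply dropped.\<close>
  have "lex_ext (gkbo F ar \<A> pr \<sigma>) us vs"
    if "lex_ext (\<lambda>x y. wpo F ar \<A> pr \<sigma> x y \<and> gkbo F ar \<A> pr \<sigma> x y) us vs" for us vs
    using that by (rule lex_ext_mono[rule_format, rotated]) simp
  then show ?case
    using wpo_sym by (intro gkbo_sym) blast+
qed

theorem theorem15:
  fixes F :: "'f set" and ar :: "'f \<Rightarrow> nat"
    and \<A> :: "('f, 'a) ord_algebra"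
    and pr :: "'f \<Rightarrow> 'f \<Rightarrow> bool" and \<sigma> :: "'f \<Rightarrow> nat list"
  assumes "finite F"
    and "well_founded_algebra F ar \<A>"
    and "quasi_precedence F pr"
    and "status F ar \<sigma>"
    and "strictly_simple F ar \<A>"
  shows "(gkbo F ar \<A> pr \<sigma> :: ('f, 'v) trm \<Rightarrow> ('f, 'v) trm \<Rightarrow> bool) = wpo F ar \<A> pr \<sigma>"
  \<comment> \<open>The equality covers the whole datatype: every rule of either order demands both
    sides in \<open>terms F ar\<close>, so neither relates anything outside it.\<close>
  using gkbo_imp_wpo[OF assms(2,5)] wpo_imp_gkbo[OF assms(2,5)] by blast

end
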